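(* Let $\alpha\ge0$, let $f\in\mathcal{W}^0_{\mathcal{H}}(\alpha)$, and let $p,q$ be positive integers. If $p=2<q$, then $s_{2,q}(f)\in\mathcal{W}^0_{\mathcal{H}}(\alpha)$ in $|z|<\frac{3-\sqrt5}{2}$. If $p\ge4$ and $q=2$, then $s_{p,2}(f)\in\mathcal{W}^0_{\mathcal{H}}(\alpha)$ in $|z|<r_0$, where $r_0\approx0.433797$ is the unique real root of the equation $1-2r-r^3-r^4-r^5=0$.
   Context: $\mathbb{D}=\{z\in\mathbb{C}:|z|<1\}$. $\mathcal{H}$ is the class of complex-valued harmonic functions $f$ in $\mathbb{D}$ with $f(0)=0$ and $f_z(0)=1$; each has the canonical representation $f=h+\overline{g}$ with $h(z)=z+\sum_{n\ge2}a_nz^n$ and $g(z)=\sum_{n\ge1}b_nz^n$ analytic in $\mathbb{D}$. For $\alpha\ge0$, $\mathcal{W}^0_{\mathcal{H}}(\alpha)$ is the class of $f=h+\overline{g}\in\mathcal{H}$ with $g'(0)=0$ (so $b_1=0$) and $\mathrm{Re}(h'(z)+\alpha zh''(z))>|g'(z)+\alpha zg''(z)|$ for all $z\in\mathbb{D}$. For $p,q\ge1$ the $(p,q)$-th partial sum of $f=h+\overline{g}$ is $s_{p,q}(f)=s_p(h)+\overline{s_q(g)}$, where $s_p(h)(z)=\sum_{k=1}^pa_kz^k$ (with $a_1=1$) and $s_q(g)(z)=\sum_{k=1}^qb_kz^k$. The phrase "$s_{p,q}(f)\in\mathcal{W}^0_{\mathcal{H}}(\alpha)$ for (in) $|z|<r$"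 means that $\mathrm{Re}(s_p(h)'(z)+\alpha zs_p(h)''(z))>|s_q(g)'(z)+\alpha zs_q(g)''(z)|$ for all $|z|<r$. *)

theory Defs
  imports "HOL-Complex_Analysis.Complex_Analysis"
begin

definition partial_x :: "(complex \<Rightarrow> complex) \<Rightarrow> complex \<Rightarrow> complex" where
  "partial_x f z = vector_derivative (\<lambda>t::real. f (z + of_real t)) (at 0)"

definition partial_y :: "(complex \<Rightarrow> complex) \<Rightarrow> complex \<Rightarrow> complex" where
  "partial_y f z = vector_derivative (\<lambda>t::real. f (z + \<i> * of_real t)) (at 0)"

definition C1_on :: "complex set \<Rightarrow> (complex \<Rightarrow> complex) \<Rightarrow> bool" where
  "C1_on S f \<longleftrightarrow>
     (\<forall>z\<in>S. (\<lambda>t::real. f (z + of_real t)) differentiable (at 0) \<and>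
            (\<lambda>t::real. f (z + \<i> * of_real t)) differentiable (at 0)) \<and>
     continuous_on S (partial_x f) \<and> continuous_on S (partial_y f)"

text \<open>Intended for open \<open>S\<close>: \<open>f\<close> is twice continuously real differentiable with zero Laplacian.\<close>

definition harmonic_on :: "complex set \<Rightarrow> (complex \<Rightarrow> complex) \<Rightarrow> bool" where
  "harmonic_on S f \<longleftrightarrow>
     C1_on S f \<and> C1_on S (partial_x f) \<and> C1_on S (partial_y f) \<and>
     (\<forall>z\<in>S. partial_x (partial_x f) z + partial_y (partial_y f) z = 0)"

text \<open>The Wirtinger derivative \<open>f\<^sub>z\<close>.\<close>

definition wirtinger_z :: "(complex \<Rightarrow> complex) \<Rightarrow> complex \<Rightarrow> complex" where
  "wirtinger_z f z = (partial_x f z - \<i> * partial_y f z) / 2"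

text \<open>Only the values on the open unit disc \<open>ball 0 1\<close> are constrained; elsewhere \<open>f\<close> is arbitrary.\<close>

definition class_H :: "(complex \<Rightarrow> complex) set" where
  "class_H = {f. harmonic_on (ball 0 1) f \<and> f 0 = 0 \<and> wirtinger_z f 0 = 1}"

text \<open>
  The representation \<open>f = h + cnj g\<close> with \<open>h\<close> and \<open>g\<close> analytic in the disc. The normalisation
  \<open>g 0 = 0\<close> (the series of \<open>g\<close> starts at \<open>n = 1\<close>) makes \<open>h\<close> and \<open>g\<close> unique on the disc.
  For \<open>f\<close> in \<open>class_H\<close> it follows that \<open>h 0 = 0\<close> and \<open>h' 0 = 1\<close>,
  i.e. \<open>h z = z + a\<^sub>2 z^2 + \<dots>\<close>.
\<close>

definition canonical_rep ::
    "(complex \<Rightarrow> complex) \<Rightarrow> (complex \<Rightarrow> complex) \<Rightarrow> (complex \<Rightarrow> complex) \<Rightarrow> bool" where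
  "canonical_rep f h g \<longleftrightarrow>
     h holomorphic_on ball 0 1 \<and> g holomorphic_on ball 0 1 \<and> g 0 = 0 \<and>
     (\<forall>z\<in>ball 0 1. f z = h z + cnj (g z))"

definition W_ineq :: "real \<Rightarrow> (complex \<Rightarrow> complex) \<Rightarrow> (complex \<Rightarrow> complex) \<Rightarrow> complex \<Rightarrow> bool" where
  "W_ineq \<alpha> h g z \<longleftrightarrow>
     Re (deriv h z + of_real \<alpha> * z * deriv (deriv h) z)
       > cmod (deriv g z + of_real \<alpha> * z * deriv (deriv g) z)"

definition class_W0H :: "real \<Rightarrow> (complex \<Rightarrow> complex) set" where
  "class_W0H \<alpha> = {f \<in> class_H. \<exists>h g. canonical_rep f h g \<and> deriv g 0 = 0 \<and>
     (\<forall>z\<in>ball 0 1. W_ineq \<alpha> h g z)}"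

text \<open>
  The sum starts at \<open>k = 1\<close>; no term is lost, as both parts of a canonical
  representation vanish at 0.
\<close>

definition taylor_psum :: "nat \<Rightarrow> (complex \<Rightarrow> complex) \<Rightarrow> complex \<Rightarrow> complex" where
  "taylor_psum n h z = (\<Sum>k=1..n. fps_nth (fps_expansion h 0) k * z ^ k)"

text \<open>
  \<open>psum_in_W0H \<alpha> p q h g r\<close> says that the \<open>(p,q)\<close>-th partial sum
  \<open>taylor_psum p h + cnj (taylor_psum q g)\<close> of \<open>f = h + cnj g\<close> lies in \<open>class_W0H \<alpha>\<close> in
  \<open>|z| < r\<close>, meaning that its two parts satisfy the defining inequality there.
\<close>

definition psum_in_W0H ::
    "real \<Rightarrow> nat \<Rightarrow> nat \<Rightarrow> (complex \<Rightarrow> complex) \<Rightarrow> (complex \<Rightarrow> complex) \<Rightarrow> real \<Rightarrow> bool" where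
  "psum_in_W0H \<alpha> p q h g r \<longleftrightarrow>
     (\<forall>z. cmod z < r \<longrightarrow> W_ineq \<alpha> (taylor_psum p h) (taylor_psum q g) z)"

end

theory Submission
  imports Defs
begin

text \<open>
  Put \<open>H = h' + \<alpha> z h''\<close> and \<open>G = g' + \<alpha> z g''\<close>, with Taylor coefficients \<open>c\<^sub>n\<close> and \<open>d\<^sub>n\<close>. The class
  condition reads \<open>|G| < Re H\<close>, and partial sums of \<open>h\<close>, \<open>g\<close> correspond to partial sums of \<open>H\<close>, \<open>G\<close>.
  Averaging over circles gives \<open>|d\<^sub>n| \<le> 1\<close>. For \<open>|\<epsilon>| = 1\<close> the function \<open>H + \<epsilon> G\<close> has positive
  real part and value 1 at 0, so \<open>|c\<^sub>n| + |d\<^sub>n| \<le> 2\<close> and \<open>Re (H + \<epsilon> G) \<ge> (1 - r) / (1 + r)\<close> on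
  \<open>|z| = r\<close>.

  For \<open>p = 2\<close> the difference of the two sides is at least
  \<open>1 - 2 r - (r\<^sup>2 + r\<^sup>3 + \<dots>) = (1 - 3 r + r\<^sup>2) / (1 - r)\<close>. For \<open>q = 2\<close>, choose \<open>\<epsilon>\<close> with
  \<open>\<epsilon> d\<^sub>1 z = - |d\<^sub>1 z|\<close> and compare with \<open>H + \<epsilon> G\<close>: the discarded terms of degree 2 and 3 involve
  only \<open>d\<^sub>n\<close>, those of degree at least 4 at most \<open>|c\<^sub>n| + |d\<^sub>n|\<close>, which leaves
  \<open>(1 - r) / (1 + r) - r\<^sup>2 / (1 - r) - r\<^sup>4 / (1 - r) = (1 - 2 r - r\<^sup>3 - r\<^sup>4 - r\<^sup>5) / (1 - r\<^sup>2)\<close>.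
\<close>

section \<open>Integrals over circles and coefficient estimates\<close>

text \<open>Cauchy's formula for the \<open>k\<close>-th derivative on the circle of radius
  \<open>\<rho>\<close>, parametrised over the unit interval and multiplied by
  \<open>\<rho> ^ k / (2 * pi * \<i>)\<close>.\<close>

lemma circle_mean:
  assumes "f holomorphic_on ball 0 1" "0 < \<rho>" "\<rho> < 1"
  shows "((\<lambda>t. f (of_real \<rho> * cis (2 * pi * t)) / cis (2 * pi * t) ^ k) has_integral
           ((deriv ^^ k) f 0 / fact k * of_real \<rho> ^ k)) {0..1}"
proof -
  have sub: "cball 0 \<rho> \<subseteq> ball (0::complex) 1" using assms by auto
  have "continuous_on (cball 0 \<rho>) f"
    using assms(1) sub by (meson holomorphic_on_imp_continuous_on holomorphic_on_subset)
  moreover have "f holomorphic_on ball 0 \<rho>"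
    using assms(1) sub by (meson ball_subset_cball holomorphic_on_subset)
  ultimately have "((\<lambda>u. f u / u ^ Suc k) has_contour_integral
      ((2 * pi * \<i>) / fact k * (deriv ^^ k) f 0)) (circlepath 0 \<rho>)"
    using Cauchy_has_contour_integral_higher_derivative_circlepath[of 0 \<rho> f 0 k] assms by simp
  then have "((\<lambda>t. f (circlepath 0 \<rho> t) / circlepath 0 \<rho> t ^ Suc k *
        vector_derivative (circlepath 0 \<rho>) (at t within {0..1})) has_integral
      ((2 * pi * \<i>) / fact k * (deriv ^^ k) f 0)) {0..1}"
    by (simp add: has_contour_integral_def)
  then have "((\<lambda>t. 2 * pi * \<i> * (f (\<rho> * cis (2 * pi * t)) / (\<rho> * cis (2 * pi * t)) ^ k))
      has_integral ((2 * pi * \<i>) / fact k * (deriv ^^ k) f 0)) {0..1}"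
    by (rule has_integral_eq[rotated])
      (use assms in \<open>simp add: vector_derivative_circlepath01, simp add: circlepath cis_conv_exp field_simps\<close>)
  then have "((\<lambda>t. of_real \<rho> ^ k / (2 * pi * \<i>) *
        (2 * pi * \<i> * (f (\<rho> * cis (2 * pi * t)) / (\<rho> * cis (2 * pi * t)) ^ k)))
      has_integral (of_real \<rho> ^ k / (2 * pi * \<i>) *
        ((2 * pi * \<i>) / fact k * (deriv ^^ k) f 0))) {0..1}"
    by (rule has_integral_mult_right)
  then show ?thesis
    using assms by (simp add: power_mult_distrib field_simps)
qed

text \<open>Lets \<open>\<rho>\<close> tend to 1: holomorphy is given only in the open disc, so
  coefficients are first estimated on smaller circles.\<close>

lemma le_of_power_scaled_le:
  fixes x c :: real
  assumes "\<And>\<rho>. 0 < \<rho> \<Longrightarrow> \<rho> < 1 \<Longrightarrow> x * \<rho> ^ k \<le> c"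
  shows "x \<le> c"
proof (rule tendsto_upperbound)
  show "((\<lambda>\<rho>::real. x * \<rho> ^ k) \<longlongrightarrow> x) (at_left 1)"
    by (auto intro!: tendsto_eq_intros)
  show "\<forall>\<^sub>F \<rho> in at_left 1. x * \<rho> ^ k \<le> c"
    using eventually_at_left_real[OF zero_less_one]
    by (rule eventually_mono) (use assms in auto)
qed simp

lemma integral_Re_circle:
  assumes "f holomorphic_on ball 0 1" "0 < \<rho>" "\<rho> < 1"
  shows "((\<lambda>t. Re (f (of_real \<rho> * cis (2 * pi * t)))) has_integral Re (f 0)) {0..1}"
  using has_integral_Re[OF circle_mean[OF assms, of 0]] by simp

text \<open>The integrand for the \<open>k\<close>-th coefficient of \<open>G\<close> is dominated
  by \<open>Re F\<close>, whose circle mean is \<open>Re (F 0)\<close>.\<close>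

lemma coeff_bound_of_norm_le_Re:
  assumes "F holomorphic_on ball 0 1" "G holomorphic_on ball 0 1"
    and "\<And>z. cmod z < 1 \<Longrightarrow> cmod (G z) \<le> Re (F z)"
  shows "cmod ((deriv ^^ k) G 0 / fact k) \<le> Re (F 0)"
proof (rule le_of_power_scaled_le)
  fix \<rho> :: real assume \<rho>: "0 < \<rho>" "\<rho> < 1"
  note G = circle_mean[OF assms(2) \<rho>, of k] and F = integral_Re_circle[OF assms(1) \<rho>]
  have "cmod ((deriv ^^ k) G 0 / fact k * of_real \<rho> ^ k) \<le> Re (F 0)"
    unfolding integral_unique[OF G, symmetric] integral_unique[OF F, symmetric]
    using assms(3) \<rho>
    by (intro integral_norm_bound_integral has_integral_integrable[OF F] has_integral_integrable[OF G])
      (auto simp: norm_divide norm_mult norm_power)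
  then show "cmod ((deriv ^^ k) G 0 / fact k) * \<rho> ^ k \<le> Re (F 0)"
    using \<rho> by (simp add: norm_mult norm_power norm_divide)
qed

lemma Caratheodory_coeff_bound:
  assumes "F holomorphic_on ball 0 1" and "\<And>z. cmod z < 1 \<Longrightarrow> 0 \<le> Re (F z)" and "k > 0"
  shows "cmod ((deriv ^^ k) F 0 / fact k) \<le> 2 * Re (F 0)"
proof (rule le_of_power_scaled_le)
  fix \<rho> :: real assume \<rho>: "0 < \<rho>" "\<rho> < 1"
  let ?e = "\<lambda>t. cis (2 * pi * t)"
  \<comment> \<open>This function vanishes at 0, so its circle mean is zero. Once
    \<open>\<rho> ^ k\<close> is divided out, conjugation turns this mean into the
    \<open>k\<close>-th coefficient integral with \<open>cnj F\<close> in place of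
    \<open>F\<close>.\<close>
  have "(\<lambda>z. F z * z ^ k) holomorphic_on ball 0 1"
    by (intro holomorphic_intros assms)
  from circle_mean[OF this \<rho>, of 0]
  have "((\<lambda>t. F (\<rho> * ?e t) * (\<rho> * ?e t) ^ k) has_integral 0) {0..1}"
    using \<open>k > 0\<close> by (simp add: zero_power)
  from has_integral_mult_right[OF this, of "1 / of_real \<rho> ^ k"]
  have "((\<lambda>t. F (\<rho> * ?e t) * ?e t ^ k) has_integral 0) {0..1}"
    using \<rho> by (simp add: power_mult_distrib)
  then have "((\<lambda>t. cnj (F (\<rho> * ?e t)) / ?e t ^ k) has_integral 0) {0..1}"
    using has_integral_cnj[of "\<lambda>t. F (\<rho> * ?e t) * ?e t ^ k" 0 "{0..1}"]
    by (simp add: o_def divide_inverse cis_cnj cis_inverse flip: power_inverse)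
  \<comment> \<open>Adding this vanishing integral replaces \<open>F\<close> by \<open>2 Re F\<close> in the integral for the coefficient.\<close>
  from has_integral_add[OF circle_mean[OF assms(1) \<rho>, of k] this]
  have G: "((\<lambda>t. (F (\<rho> * ?e t) + cnj (F (\<rho> * ?e t))) / ?e t ^ k) has_integral
      ((deriv ^^ k) F 0 / fact k * of_real \<rho> ^ k)) {0..1}"
    by (simp add: add_divide_distrib)
  have H: "((\<lambda>t. 2 * Re (F (of_real \<rho> * ?e t))) has_integral 2 * Re (F 0)) {0..1}"
    by (intro has_integral_mult_right integral_Re_circle assms \<rho>)
  have "cmod ((deriv ^^ k) F 0 / fact k * of_real \<rho> ^ k) \<le> 2 * Re (F 0)"
    unfolding integral_unique[OF G, symmetric] integral_unique[OF H, symmetric]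
    using assms(2) \<rho>
    by (intro integral_norm_bound_integral has_integral_integrable[OF H] has_integral_integrable[OF G])
      (auto simp: norm_divide norm_mult norm_power complex_add_cnj)
  then show "cmod ((deriv ^^ k) F 0 / fact k) * \<rho> ^ k \<le> 2 * Re (F 0)"
    using \<rho> by (simp add: norm_mult norm_power norm_divide)
qed

text \<open>Composing \<open>F\<close> with the Cayley transform of the right half-plane gives a
  self-map of the disc fixing 0. Schwarz's lemma then confines \<open>F z\<close> to a disc whose
  leftmost point is the bound.\<close>

lemma Caratheodory_Re_lower_bound:
  assumes "F holomorphic_on ball 0 1" and "F 0 = 1"
    and pos: "\<And>z. cmod z < 1 \<Longrightarrow> 0 < Re (F z)" and z: "cmod z < 1"
  shows "(1 - cmod z) / (1 + cmod z) \<le> Re (F z)"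
proof -
  define w where "w = (\<lambda>z. (F z - 1) / (F z + 1))"
  have nz: "F z + 1 \<noteq> 0" if "cmod z < 1" for z
    using pos[OF that] by (auto simp: complex_eq_iff)
  have lt: "cmod (F z - 1) < cmod (F z + 1)" if "cmod z < 1" for z
    using pos[OF that] by (simp add: cmod_def power2_eq_square algebra_simps)
  have "cmod (w z) \<le> cmod z"
  proof (rule Schwarz_Lemma(1))
    show "w holomorphic_on ball 0 1"
      unfolding w_def using nz by (intro holomorphic_intros assms) auto
    show "w 0 = 0" by (simp add: w_def assms)
    show "cmod (w z) < 1" if "cmod z < 1" for z
      using lt[OF that] nz[OF that] by (simp add: w_def norm_divide)
  qed fact
  then have "cmod (F z - 1) \<le> cmod z * cmod (F z + 1)"
    using nz[OF z] by (simp add: w_def norm_divide field_simps)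
  then have "cmod (F z - 1) ^ 2 \<le> cmod z ^ 2 * cmod (F z + 1) ^ 2"
    by (metis norm_ge_zero power_mono power_mult_distrib)
  then have le: "(Re (F z) - 1)\<^sup>2 + (Im (F z))\<^sup>2 \<le> (cmod z)\<^sup>2 * ((Re (F z) + 1)\<^sup>2 + (Im (F z))\<^sup>2)"
    by (simp add: cmod_power2)
  have "(cmod z)\<^sup>2 * (Im (F z))\<^sup>2 \<le> 1 * (Im (F z))\<^sup>2"
    using z by (intro mult_right_mono) (auto simp: power_le_one)
  then have "\<bar>Re (F z) - 1\<bar>\<^sup>2 \<le> (cmod z * (Re (F z) + 1))\<^sup>2"
    using le by (simp add: algebra_simps power2_eq_square)
  then have "\<bar>Re (F z) - 1\<bar> \<le> cmod z * (Re (F z) + 1)"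
    by (rule power2_le_imp_le) (use pos[OF z] in auto)
  then show ?thesis
    by (auto simp: field_simps pos_divide_le_eq add_pos_nonneg)
qed

lemma obtain_rotation:
  fixes w u :: complex
  assumes "cmod u = 1"
  obtains \<epsilon> where "cmod \<epsilon> = 1" "\<epsilon> * w = of_real (cmod w) * u"
proof (cases "w = 0")
  case False
  then have "u * cnj w / cmod w * w = cmod w * u"
    by (simp add: field_simps complex_norm_square[symmetric] power2_eq_square)
  moreover have "cmod (u * cnj w / cmod w) = 1"
    using False assms by (simp add: norm_mult norm_divide)
  ultimately show ?thesis using that by blast
qed (use that[of 1] in simp)

text \<open>Indexed from 0 with zeros below \<open>m\<close>, so that the tail can serve as a
  termwise majorant of a power series.\<close>

lemma geometric_tail_sums:
  fixes x :: real
  assumes "\<bar>x\<bar> < 1"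
  shows "(\<lambda>n. if n < m then 0 else x ^ n) sums (x ^ m / (1 - x))"
proof -
  have "(\<lambda>n. x ^ m * x ^ n) sums (x ^ m * (1 / (1 - x)))"
    using assms by (intro sums_mult geometric_sums) simp
  then have "(\<lambda>n. if n + m < m then 0 else x ^ (n + m)) sums (x ^ m / (1 - x))"
    by (simp add: power_add mult.commute)
  then show ?thesis
    by (subst (asm) sums_iff_shift) simp
qed

section \<open>Pairs with \<open>|G| < Re H\<close> and their partial sums\<close>

text \<open>The parameter \<open>\<alpha>\<close> is absorbed into \<open>H\<close> and
  \<open>G\<close>, so the estimates below are free of it.\<close>

locale dominated_pair =
  fixes H G :: "complex \<Rightarrow> complex"
  assumes holH: "H holomorphic_on ball 0 1" and holG: "G holomorphic_on ball 0 1"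
    and H0: "H 0 = 1" and G0: "G 0 = 0"
    and dominated: "cmod z < 1 \<Longrightarrow> cmod (G z) < Re (H z)"
begin

definition c where "c k = (deriv ^^ k) H 0 / fact k"
definition d where "d k = (deriv ^^ k) G 0 / fact k"

lemma c_0 [simp]: "c 0 = 1" and d_0 [simp]: "d 0 = 0"
  by (simp_all add: c_def d_def H0 G0)

lemma H_sums: "cmod z < 1 \<Longrightarrow> (\<lambda>n. c n * z ^ n) sums H z"
  and G_sums: "cmod z < 1 \<Longrightarrow> (\<lambda>n. d n * z ^ n) sums G z"
  using holomorphic_power_series[OF holH, of z] holomorphic_power_series[OF holG, of z]
  by (simp_all add: c_def d_def)

lemma norm_d_le: "cmod (d k) \<le> 1"
  using coeff_bound_of_norm_le_Re[OF holH holG] dominated H0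
  by (simp add: d_def less_imp_le)

lemma Re_rotated_pos:
  assumes "cmod \<epsilon> = 1" "cmod z < 1"
  shows "0 < Re (H z + \<epsilon> * G z)"
proof -
  have "- Re (\<epsilon> * G z) \<le> cmod (G z)"
    using abs_Re_le_cmod[of "\<epsilon> * G z"] assms(1) by (simp add: norm_mult)
  then show ?thesis using dominated[OF assms(2)] by simp
qed

lemma holomorphic_rotated: "(\<lambda>z. H z + \<epsilon> * G z) holomorphic_on ball 0 1"
  by (intro holomorphic_intros holH holG)

text \<open>Rotating \<open>G\<close> so that \<open>\<epsilon> * d k\<close> points in the
  direction of \<open>c k\<close> makes the moduli add up in the \<open>k\<close>-th coefficient of
  \<open>H + \<epsilon> * G\<close>, to which the Caratheodory bound applies.\<close>

lemma norm_c_add_norm_d_le: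
  assumes "k > 0"
  shows "cmod (c k) + cmod (d k) \<le> 2"
proof -
  \<comment> \<open>The default 1 keeps \<open>u\<close> unimodular when \<open>c k = 0\<close>,
    where \<open>sgn\<close> would give 0.\<close>
  define u where "u = (if c k = 0 then 1 else sgn (c k))"
  have u: "cmod u = 1" "c k = of_real (cmod (c k)) * u"
    by (auto simp: u_def norm_sgn sgn_eq norm_divide)
  obtain \<epsilon> where \<epsilon>: "cmod \<epsilon> = 1" "\<epsilon> * d k = of_real (cmod (d k)) * u"
    using obtain_rotation[OF u(1)] by blast
  have "(deriv ^^ k) (\<lambda>z. H z + \<epsilon> * G z) 0 = (deriv ^^ k) H 0 + \<epsilon> * (deriv ^^ k) G 0"
    using holH holG
    by (subst higher_deriv_add[where S = "ball 0 1"])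
      (auto intro!: holomorphic_intros simp: higher_deriv_cmult[where A = "ball 0 1"])
  then have "(deriv ^^ k) (\<lambda>z. H z + \<epsilon> * G z) 0 / fact k = c k + \<epsilon> * d k"
    by (simp add: c_def d_def add_divide_distrib)
  also have "c k + \<epsilon> * d k = of_real (cmod (c k) + cmod (d k)) * u"
    using u(2) \<epsilon>(2) by (simp add: algebra_simps)
  finally have eq: "(deriv ^^ k) (\<lambda>z. H z + \<epsilon> * G z) 0 / fact k = \<dots>" .
  have "cmod ((deriv ^^ k) (\<lambda>z. H z + \<epsilon> * G z) 0 / fact k) \<le> 2 * Re (H 0 + \<epsilon> * G 0)"
    using Re_rotated_pos[OF \<epsilon>(1)] assms
    by (intro Caratheodory_coeff_bound holomorphic_rotated) (simp_all add: less_imp_le)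
  then show ?thesis
    unfolding eq norm_mult u(1) norm_of_real by (simp add: H0 G0)
qed

lemma psum_2_dominates:
  assumes z: "cmod z < (3 - sqrt 5) / 2"
  shows "cmod (\<Sum>n<q. d n * z ^ n) < Re (\<Sum>n<2. c n * z ^ n)"
proof -
  define \<rho> where "\<rho> = cmod z"
  have sq5: "sqrt 5 > 2" by (rule real_less_rsqrt) simp
  have \<rho>: "0 \<le> \<rho>" "\<rho> < (3 - sqrt 5) / 2" "\<rho> < 1"
    using z sq5 by (auto simp: \<rho>_def)
  \<comment> \<open>The radius is the smaller root of
    \<open>1 - 3 * \<rho> + \<rho>\<^sup>2\<close>, factored here at its two roots.\<close>
  have "0 < ((3 - sqrt 5) / 2 - \<rho>) * ((3 + sqrt 5) / 2 - \<rho>)"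
    using \<rho> sq5 by (intro mult_pos_pos) auto
  also have "\<dots> = 1 - 3 * \<rho> + \<rho>\<^sup>2"
    by (simp add: field_simps power2_eq_square)
  finally have "0 < (1 - 3 * \<rho> + \<rho>\<^sup>2) / (1 - \<rho>)"
    using \<rho> by simp
  also have "\<dots> = 1 - 2 * \<rho> - \<rho>\<^sup>2 / (1 - \<rho>)"
    using \<rho> by (simp add: field_simps power2_eq_square)
  finally have key: "2 * \<rho> + \<rho>\<^sup>2 / (1 - \<rho>) < 1" by simp
  \<comment> \<open>The linear term keeps \<open>cmod (d 1)\<close> instead of the bound 1, to be
    combined later with \<open>cmod (c 1)\<close> through
    \<open>norm_c_add_norm_d_le\<close>.\<close>
  define b where "b n = (if n = 1 then cmod (d 1) * \<rho> else 0) + (if n < 2 then 0 else \<rho> ^ n)" for n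
  have b: "b sums (cmod (d 1) * \<rho> + \<rho>\<^sup>2 / (1 - \<rho>))"
    unfolding b_def using \<rho> by (intro sums_add sums_single geometric_tail_sums) simp
  have "cmod (d n * z ^ n) \<le> b n" for n
  proof -
    consider "n = 0" | "n = 1" | "n \<ge> 2" by linarith
    then show ?thesis
      using norm_d_le[of n] by cases (auto simp: b_def norm_mult norm_power \<rho>_def mult_left_le_one_le)
  qed
  then have "cmod (\<Sum>n<q. d n * z ^ n) \<le> (\<Sum>n<q. b n)"
    by (intro sum_norm_le)
  also have "\<dots> \<le> cmod (d 1) * \<rho> + \<rho>\<^sup>2 / (1 - \<rho>)"
    unfolding sums_unique[OF b]
    using \<rho> by (intro sum_le_suminf sums_summable[OF b]) (auto simp: b_def)
  also have "\<dots> < 1 - cmod (c 1) * \<rho>"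
    using mult_right_mono[OF norm_c_add_norm_d_le[of 1] \<rho>(1)] key
    by (simp add: algebra_simps)
  also have "\<dots> \<le> Re (\<Sum>n<2. c n * z ^ n)"
    using abs_Re_le_cmod[of "c 1 * z"] by (simp add: numeral_2_eq_2 norm_mult \<rho>_def)
  finally show ?thesis .
qed

lemma psum_dominates_linear:
  assumes "p \<ge> 4" and z: "cmod z < 1"
    and pos: "0 < 1 - 2 * cmod z - cmod z ^ 3 - cmod z ^ 4 - cmod z ^ 5"
  shows "cmod (\<Sum>n<2. d n * z ^ n) < Re (\<Sum>n<p. c n * z ^ n)"
proof -
  define \<rho> where "\<rho> = cmod z"
  have \<rho>: "0 \<le> \<rho>" "\<rho> < 1" using z by (auto simp: \<rho>_def)
  obtain \<epsilon> where \<epsilon>: "cmod \<epsilon> = 1" "\<epsilon> * (d 1 * z) = of_real (cmod (d 1 * z)) * (-1)"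
    using obtain_rotation[of "-1" "d 1 * z"] by auto
  \<comment> \<open>By the choice of \<open>\<epsilon>\<close>, \<open>Re S\<close> is exactly the
    difference of the two sides of the claim.\<close>
  define S where "S = (\<Sum>n<p. c n * z ^ n) + \<epsilon> * (d 1 * z)"
  have "(\<lambda>n. if n < p then c n * z ^ n else 0) sums (\<Sum>n<p. c n * z ^ n)"
    using sums_If_finite[of "\<lambda>n. n < p" "\<lambda>n. c n * z ^ n"] by (simp add: lessThan_def)
  moreover have "(\<lambda>n. if n = 1 then \<epsilon> * (d n * z ^ n) else 0) sums (\<epsilon> * (d 1 * z))"
    using sums_single[of 1 "\<lambda>n. \<epsilon> * (d n * z ^ n)"] by simp
  ultimately have S: "(\<lambda>n. (if n < p then c n * z ^ n else 0) +
      (if n = 1 then \<epsilon> * (d n * z ^ n) else 0)) sums S"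
    unfolding S_def by (rule sums_add)
  define r where "r n = (c n * z ^ n + \<epsilon> * (d n * z ^ n)) -
      ((if n < p then c n * z ^ n else 0) + (if n = 1 then \<epsilon> * (d n * z ^ n) else 0))" for n
  have r: "r sums (H z + \<epsilon> * G z - S)"
    unfolding r_def using H_sums[OF z] G_sums[OF z] S by (intro sums_diff sums_add sums_mult)
  \<comment> \<open>Since \<open>p \<ge> 4\<close>, the coefficients \<open>c n\<close> enter
    \<open>r\<close> only from degree 4 on: degrees 2 and 3 cost one power of \<open>\<rho>\<close>,
    higher ones at most two. Degrees 0 and 1 cancel in \<open>r\<close>.\<close>
  define b where "b n = (if n < 2 then 0 else \<rho> ^ n) + (if n < 4 then 0 else \<rho> ^ n)" for n :: nat
  have b: "b sums (\<rho> ^ 2 / (1 - \<rho>) + \<rho> ^ 4 / (1 - \<rho>))"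
    unfolding b_def using \<rho> by (intro sums_add geometric_tail_sums) simp_all
  have "cmod (r n) \<le> b n" for n
  proof -
    consider "n = 0" | "n = 1" | "n \<ge> 2" "n < p" | "n \<ge> p" by linarith
    then show ?thesis
    proof cases
      case 3
      then have "cmod (r n) = cmod (d n) * \<rho> ^ n"
        by (simp add: r_def norm_mult norm_power \<epsilon>(1) \<rho>_def)
      also have "\<dots> \<le> \<rho> ^ n"
        using norm_d_le[of n] \<rho> by (simp add: mult_left_le_one_le)
      finally show ?thesis using 3 \<rho> by (auto simp: b_def intro: order_trans)
    next
      case 4
      then have "r n = c n * z ^ n + \<epsilon> * (d n * z ^ n)"
        using assms(1) by (simp add: r_def)
      also have "cmod \<dots> \<le> cmod (c n * z ^ n) + cmod (\<epsilon> * (d n * z ^ n))"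
        by (rule norm_triangle_ineq)
      also have "\<dots> = (cmod (c n) + cmod (d n)) * \<rho> ^ n"
        by (simp add: norm_mult norm_power \<epsilon>(1) \<rho>_def algebra_simps)
      also have "\<dots> \<le> 2 * \<rho> ^ n"
        using norm_c_add_norm_d_le[of n] 4 assms(1) \<rho> by (intro mult_right_mono) auto
      finally show ?thesis using 4 assms(1) by (simp add: b_def)
    qed (use assms(1) in \<open>auto simp: r_def b_def\<close>)
  qed
  then have "cmod (H z + \<epsilon> * G z - S) \<le> \<rho> ^ 2 / (1 - \<rho>) + \<rho> ^ 4 / (1 - \<rho>)"
    by (rule norm_sums_le[OF r b])
  moreover have "(1 - \<rho>) / (1 + \<rho>) \<le> Re (H z + \<epsilon> * G z)"
    unfolding \<rho>_def using Re_rotated_pos[OF \<epsilon>(1)] z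
    by (intro Caratheodory_Re_lower_bound[OF holomorphic_rotated]) (auto simp: H0 G0)
  moreover have "0 < (1 - 2 * \<rho> - \<rho> ^ 3 - \<rho> ^ 4 - \<rho> ^ 5) / ((1 - \<rho>) * (1 + \<rho>))"
    using pos \<rho> by (intro divide_pos_pos mult_pos_pos) (auto simp: \<rho>_def add_pos_nonneg)
  moreover have "\<dots> = (1 - \<rho>) / (1 + \<rho>) - (\<rho> ^ 2 / (1 - \<rho>) + \<rho> ^ 4 / (1 - \<rho>))"
  proof -
    have "1 - 2 * \<rho> - \<rho> ^ 3 - \<rho> ^ 4 - \<rho> ^ 5 = (1 - \<rho>) * (1 - \<rho>) - (\<rho> ^ 2 + \<rho> ^ 4) * (1 + \<rho>)"
      by (simp add: algebra_simps eval_nat_numeral)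
    then show ?thesis
      using \<rho> by (simp add: add_divide_distrib[symmetric] diff_frac_eq mult.commute)
  qed
  ultimately have S_pos: "0 < Re S"
    using abs_Re_le_cmod[of "H z + \<epsilon> * G z - S"] by simp
  have "Re S = Re (\<Sum>n<p. c n * z ^ n) - cmod (d 1 * z)"
    unfolding S_def \<epsilon>(2) by simp
  then have "cmod (d 1 * z) < Re (\<Sum>n<p. c n * z ^ n)"
    using S_pos by linarith
  moreover have "(\<Sum>n<2. d n * z ^ n) = d 1 * z"
    by (simp add: numeral_2_eq_2)
  ultimately show ?thesis by (simp only:)
qed

end

section \<open>The quintic and its root\<close>

lemma quintic_strict_antimono:
  fixes x y :: real
  assumes "x < y"
  shows "1 - 2 * y - y ^ 3 - y ^ 4 - y ^ 5 < 1 - 2 * x - x ^ 3 - x ^ 4 - x ^ 5"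
proof (rule DERIV_neg_imp_decreasing[OF assms])
  fix t :: real
  have "((\<lambda>x. 1 - 2 * x - x ^ 3 - x ^ 4 - x ^ 5) has_real_derivative
      (- 2 - 3 * t\<^sup>2 - 4 * t ^ 3 - 5 * t ^ 4)) (at t)"
    by (auto intro!: derivative_eq_intros)
  \<comment> \<open>The second factor is \<open>5 * t\<^sup>2 + 4 * t + 3\<close> with squares
    completed, so the derivative is at most -2 on the whole real line.\<close>
  moreover have "0 \<le> t\<^sup>2 * ((2 * t + 1)\<^sup>2 + t\<^sup>2 + 2)"
    by (intro mult_nonneg_nonneg add_nonneg_nonneg) auto
  then have "- 2 - 3 * t\<^sup>2 - 4 * t ^ 3 - 5 * t ^ 4 < 0"
    by (simp add: algebra_simps eval_nat_numeral)
  ultimately show "\<exists>y. ((\<lambda>x. 1 - 2 * x - x ^ 3 - x ^ 4 - x ^ 5) has_real_derivative y) (at t) \<and> y < 0"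
    by blast
qed

lemma quintic_root:
  obtains r0 :: real where "\<And>r. 1 - 2 * r - r ^ 3 - r ^ 4 - r ^ 5 = 0 \<longleftrightarrow> r = r0"
    and "\<bar>r0 - 0.433797\<bar> < 0.0000005"
    and "\<And>r. r < r0 \<Longrightarrow> 0 < 1 - 2 * r - r ^ 3 - r ^ 4 - r ^ 5"
proof -
  let ?P = "\<lambda>r::real. 1 - 2 * r - r ^ 3 - r ^ 4 - r ^ 5"
  \<comment> \<open>Both endpoints lie within 0.0000004 of 0.433797, inside the required
    tolerance.\<close>
  have "\<exists>r. 0.4337966 \<le> r \<and> r \<le> 0.4337974 \<and> ?P r = 0"
    by (rule IVT2) (simp_all add: eval_nat_numeral)
  then obtain r0 where r0: "0.4337966 \<le> r0" "r0 \<le> 0.4337974" "?P r0 = 0" by blast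
  show thesis
  proof (rule that[of r0])
    show "?P r = 0 \<longleftrightarrow> r = r0" for r
      using quintic_strict_antimono[of r r0] quintic_strict_antimono[of r0 r] r0(3)
      by (cases r r0 rule: linorder_cases) auto
    show "\<bar>r0 - 0.433797\<bar> < 0.0000005"
      using r0(1,2) by (intro abs_less_iff[THEN iffD2] conjI) simp_all
    show "0 < ?P r" if "r < r0" for r
      using quintic_strict_antimono[OF that] r0(3) by simp
  qed
qed

section \<open>Transfer between the harmonic class and dominated pairs\<close>

text \<open>Makes \<open>h'\<close> and \<open>g'\<close> independent of the choice of the canonical representation.\<close>

lemma canonical_rep_deriv:
  assumes "canonical_rep f h g" and z: "cmod z < 1"
  shows "deriv h z = wirtinger_z f z"
    and "deriv g z = cnj ((partial_x f z + \<i> * partial_y f z) / 2)"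
proof -
  have h: "(h has_field_derivative deriv h z) (at z)" and g: "(g has_field_derivative deriv g z) (at z)"
    using assms by (auto simp: canonical_rep_def intro!: holomorphic_derivI[of _ "ball 0 1"])
  \<comment> \<open>One directional derivative covers both partials, by taking \<open>v = 1\<close>
    and \<open>v = \<i>\<close>.\<close>
  have dir: "vector_derivative (\<lambda>t::real. f (z + v * of_real t)) (at 0) =
      v * deriv h z + cnj (v * deriv g z)" if v: "cmod v = 1" for v
  proof (rule vector_derivative_at)
    have lin: "((\<lambda>t::real. z + v * of_real t) has_vector_derivative v) (at 0)"
      by (auto intro!: derivative_eq_intros has_vector_derivative_real_field)
    have "((\<lambda>t::real. h (z + v * of_real t) + cnj (g (z + v * of_real t))) has_vector_derivative
        v * deriv h z + cnj (v * deriv g z)) (at 0)"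
      using field_vector_diff_chain_at[OF lin, of h "deriv h z"]
        field_vector_diff_chain_at[OF lin, of g "deriv g z"] h g
      by (intro has_vector_derivative_add has_vector_derivative_cnj) (simp_all add: o_def)
    \<comment> \<open>The representation of \<open>f\<close> holds only in the disc, hence the
      restriction to the open set of \<open>t\<close> for which the line stays inside it.\<close>
    then show "((\<lambda>t::real. f (z + v * of_real t)) has_vector_derivative
        v * deriv h z + cnj (v * deriv g z)) (at 0)"
      by (rule has_vector_derivative_transform_within_open[where S = "(\<lambda>t. z + v * of_real t) -` ball 0 1"])
        (use assms in \<open>auto simp: canonical_rep_def intro!: open_vimage continuous_intros\<close>)
  qed
  have px: "partial_x f z = deriv h z + cnj (deriv g z)"
    and py: "partial_y f z = \<i> * deriv h z + cnj (\<i> * deriv g z)"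
    unfolding partial_x_def partial_y_def using dir[of 1] dir[of \<i>] by simp_all
  show "deriv h z = wirtinger_z f z"
    and "deriv g z = cnj ((partial_x f z + \<i> * partial_y f z) / 2)"
    unfolding wirtinger_z_def px py by (simp_all add: algebra_simps)
qed

lemma fps_expansion_deriv_plus:
  assumes "h holomorphic_on ball 0 1"
  shows "(deriv ^^ n) (\<lambda>z. deriv h z + of_real \<alpha> * z * deriv (deriv h) z) 0 / fact n =
    of_nat (Suc n) * (1 + of_real \<alpha> * of_nat n) * fps_nth (fps_expansion h 0) (Suc n)"
proof -
  let ?F = "fps_expansion h 0"
  have h: "h has_fps_expansion ?F"
    using assms by (intro has_fps_expansion_fps_expansion[of "ball 0 1"]) auto
  have "(\<lambda>z. deriv h z + of_real \<alpha> * z * deriv (deriv h) z) has_fps_expansion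
      fps_deriv ?F + fps_const (of_real \<alpha>) * fps_X * fps_deriv (fps_deriv ?F)"
    by (intro has_fps_expansion_add has_fps_expansion_mult has_fps_expansion_deriv
      has_fps_expansion_const has_fps_expansion_fps_X h)
  from fps_nth_fps_expansion[OF this, of n] show ?thesis
    by (cases n) (simp_all add: mult.assoc algebra_simps)
qed

text \<open>The multipliers agree with those in \<open>fps_expansion_deriv_plus\<close>, so the
  operator commutes with truncation. It lowers degrees by one, so degrees up to \<open>p\<close>
  become degrees below \<open>p\<close>.\<close>

lemma taylor_psum_deriv_plus:
  "deriv (taylor_psum p h) z + of_real \<alpha> * z * deriv (deriv (taylor_psum p h)) z =
    (\<Sum>n<p. of_nat (Suc n) * (1 + of_real \<alpha> * of_nat n) * fps_nth (fps_expansion h 0) (Suc n) * z ^ n)"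
proof -
  define a where "a = fps_nth (fps_expansion h 0)"
  have T: "taylor_psum p h = (\<lambda>z. \<Sum>n<p. a (Suc n) * z ^ Suc n)"
    unfolding taylor_psum_def a_def
    by (simp add: sum.atLeast1_atMost_eq fun_eq_iff)
  have d1: "deriv (taylor_psum p h) = (\<lambda>z. \<Sum>n<p. a (Suc n) * of_nat (Suc n) * z ^ n)"
    unfolding T mult.assoc
    by (rule ext, intro DERIV_imp_deriv DERIV_sum DERIV_cmult) (use DERIV_power_Suc[OF DERIV_ident] in simp)
  have d2: "deriv (deriv (taylor_psum p h)) = (\<lambda>z. \<Sum>n<p. a (Suc n) * of_nat (Suc n) * (of_nat n * z ^ (n - 1)))"
    unfolding d1
    by (rule ext, intro DERIV_imp_deriv DERIV_sum DERIV_cmult) (use DERIV_power[OF DERIV_ident] in simp)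
  have "z * (of_nat n * z ^ (n - 1)) = of_nat n * z ^ n" for n
    by (cases n) auto
  then have "of_real \<alpha> * z * (a (Suc n) * of_nat (Suc n) * (of_nat n * z ^ (n - 1))) =
      of_real \<alpha> * a (Suc n) * of_nat (Suc n) * (of_nat n * z ^ n)" for n
    by (metis (no_types, lifting) mult.assoc mult.left_commute)
  then show ?thesis
    unfolding d2 unfolding d1 a_def[symmetric] sum_distrib_left sum.distrib[symmetric]
    by (intro sum.cong) (simp_all add: algebra_simps)
qed

theorem theorem4p11:
  fixes \<alpha> :: real and f h g :: "complex \<Rightarrow> complex" and p q :: nat
  assumes "\<alpha> \<ge> 0"
    and "f \<in> class_W0H \<alpha>"
    and "canonical_rep f h g"
    and "p \<ge> 1" and "q \<ge> 1"
  shows "(p = 2 \<and> 2 < q \<longrightarrow> psum_in_W0H \<alpha> p q h g ((3 - sqrt 5) / 2)) \<and>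
    (\<exists>r0::real.
       (\<forall>r::real. 1 - 2 * r - r ^ 3 - r ^ 4 - r ^ 5 = 0 \<longleftrightarrow> r = r0) \<and>
       \<bar>r0 - 0.433797\<bar> < 0.0000005 \<and>
       (p \<ge> 4 \<and> q = 2 \<longrightarrow> psum_in_W0H \<alpha> p q h g r0))"
proof -
  from assms(2) obtain h1 g1 where rep1: "canonical_rep f h1 g1" and g1: "deriv g1 0 = 0"
    and W1: "\<And>z. z \<in> ball 0 1 \<Longrightarrow> W_ineq \<alpha> h1 g1 z" and "wirtinger_z f 0 = 1"
    by (auto simp: class_W0H_def class_H_def)
  have hol: "h holomorphic_on ball 0 1" "g holomorphic_on ball 0 1"
    using assms(3) by (auto simp: canonical_rep_def)
  \<comment> \<open>The representation supplied by the class may differ from the given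
    \<open>h\<close>, \<open>g\<close>; equality of the derivatives carries the inequality
    over.\<close>
  have eq: "deriv h z = deriv h1 z" "deriv g z = deriv g1 z" if "z \<in> ball 0 1" for z
    using canonical_rep_deriv[OF rep1, of z] canonical_rep_deriv[OF assms(3), of z] that
    unfolding mem_ball_0 by metis+
  have eq2: "deriv (deriv h) z = deriv (deriv h1) z" "deriv (deriv g) z = deriv (deriv g1) z"
    if "z \<in> ball 0 1" for z
    by (rule deriv_cong_ev, rule eventually_mono[OF eventually_nhds_in_open[OF open_ball that]],
      simp_all add: eq)+
  define H where "H = (\<lambda>z. deriv h z + of_real \<alpha> * z * deriv (deriv h) z)"
  define G where "G = (\<lambda>z. deriv g z + of_real \<alpha> * z * deriv (deriv g) z)"
  interpret dominated_pair H G
  proof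
    show "H holomorphic_on ball 0 1" "G holomorphic_on ball 0 1"
      unfolding H_def G_def by (intro holomorphic_intros hol open_ball)+
    show "H 0 = 1" "G 0 = 0"
      using canonical_rep_deriv(1)[OF assms(3), of 0] \<open>wirtinger_z f 0 = 1\<close> eq(2)[of 0] g1
      by (simp_all add: H_def G_def)
    show "cmod (G z) < Re (H z)" if "cmod z < 1" for z
      using W1[of z] that by (simp add: W_ineq_def H_def G_def eq eq2)
  qed
  have "c n = of_nat (Suc n) * (1 + of_real \<alpha> * of_nat n) * fps_nth (fps_expansion h 0) (Suc n)"
    and "d n = of_nat (Suc n) * (1 + of_real \<alpha> * of_nat n) * fps_nth (fps_expansion g 0) (Suc n)" for n
    unfolding c_def d_def unfolding H_def G_def by (rule fps_expansion_deriv_plus hol)+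
  then have W: "W_ineq \<alpha> (taylor_psum m h) (taylor_psum n g) z \<longleftrightarrow>
      cmod (\<Sum>k<n. d k * z ^ k) < Re (\<Sum>k<m. c k * z ^ k)" for m n z
    unfolding W_ineq_def taylor_psum_deriv_plus by (simp only:)
  obtain r0 :: real where r0: "\<And>r. 1 - 2 * r - r ^ 3 - r ^ 4 - r ^ 5 = 0 \<longleftrightarrow> r = r0"
    "\<bar>r0 - 0.433797\<bar> < 0.0000005"
    "\<And>r. r < r0 \<Longrightarrow> 0 < 1 - 2 * r - r ^ 3 - r ^ 4 - r ^ 5"
    using quintic_root by blast
  have "psum_in_W0H \<alpha> 2 q h g ((3 - sqrt 5) / 2)"
    unfolding psum_in_W0H_def W using psum_2_dominates by blast
  moreover have "psum_in_W0H \<alpha> p 2 h g r0" if "p \<ge> 4"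
    unfolding psum_in_W0H_def W
  proof (intro allI impI psum_dominates_linear[OF that])
    fix z assume "cmod z < r0"
    then show "cmod z < 1" using abs_le_D1[OF less_imp_le[OF r0(2)]] by simp
    show "0 < 1 - 2 * cmod z - cmod z ^ 3 - cmod z ^ 4 - cmod z ^ 5"
      using r0(3) \<open>cmod z < r0\<close> .
  qed
  ultimately show ?thesis
    using r0(1,2) by blast
qed

end
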